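(* Let $p,q$ be coprime integers with $|p|+|q|>2$, let $n\ge1$, and let $A,B\in GL_n(\mathbb{C})$ satisfy $B^{-1}A^pB=A^q$. Then $A$ is a polynomial in $A^q$ or in $A^p$. In particular, $B^{-1}AB$ and $A$ commute.
   Context: "$A$ is a polynomial in $X$" means that $A=f(X)$ for some $f\in\mathbb{C}[x]$. *)

theory Defs
  imports "Jordan_Normal_Form.Matrix" "HOL-Computational_Algebra.Polynomial"
begin

abbreviation GL :: "nat \<Rightarrow> complex mat monoid" where
  "GL n \<equiv> units_of (ring_mat TYPE(complex) n ())"

(* Meaningful for square X only; the constant term is multiplied by X ^\<^sub>m 0, the identity. *)
definition eval_poly_mat :: "complex poly \<Rightarrow> complex mat \<Rightarrow> complex mat" where
  "eval_poly_mat f X =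
     finsum (ring_mat TYPE(complex) (dim_row X) ()) (\<lambda>k. coeff f k \<cdot>\<^sub>m (X ^\<^sub>m k)) {..degree f}"

definition polynomial_in :: "complex mat \<Rightarrow> complex mat \<Rightarrow> bool" where
  "polynomial_in A X \<longleftrightarrow> (\<exists>f. A = eval_poly_mat f X)"

end

theory Submission
  imports Defs "Jordan_Normal_Form.Schur_Decomposition"
begin

text \<open>
  Iterating the relation shows that $A^{p^k}$ and $A^{q^k}$ are similar for all $k$. As $A$ has
  finitely many eigenvalues, the pigeonhole principle makes every eigenvalue a root of unity of
  order coprime to $q$. Hence $(A^N - 1)^n = 0$ for some $N > 0$ coprime to $q$. Modulo
  $(x^N - 1)^n$ the variable $x$ is a polynomial in $x^q$, so $A = f(A^q)$. Conjugating,
  $B A B^{-1} = f(A^p)$, which commutes with $A$.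
\<close>

section \<open>The variable as a polynomial in its power\<close>

lemma pcompose_power: "pcompose (f ^ k) g = pcompose f g ^ k" for f g :: "'a::comm_ring_1 poly"
  by (induction k) (auto simp: pcompose_mult pcompose_1)

text \<open>Polynomial expressions respect congruence modulo \<open>g - h\<close>. The induction
  step adds and subtracts \<open>g * pcompose f h\<close>.\<close>

lemma diff_dvd_pcompose_diff:
  fixes f g h :: "'a::comm_ring_1 poly"
  shows "g - h dvd pcompose f g - pcompose f h"
proof (induction f)
  case (pCons a f)
  have "pcompose (pCons a f) g - pcompose (pCons a f) h
      = g * (pcompose f g - pcompose f h) + (g - h) * pcompose f h"
    by (simp add: pcompose_pCons algebra_simps)
  then show ?case using pCons.IH by simp
qed simp

lemma diff_dvd_power_diff: "a - b dvd a ^ k - b ^ k" for a b :: "'a::comm_ring_1"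
proof (induction k)
  case (Suc k)
  have "a ^ Suc k - b ^ Suc k = a * (a ^ k - b ^ k) + (a - b) * b ^ k"
    by (simp add: algebra_simps)
  then show ?case using Suc by simp
qed simp

text \<open>Hensel lifting in the exponent \<open>j\<close>: a solution modulo \<open>Y ^ j\<close>
  is corrected by a multiple of \<open>Y ^ j\<close> to one modulo \<open>Y ^ Suc j\<close>. For
  \<open>j = 0\<close> the modulus is 1. Characteristic 0 makes the constant \<open>q ^ j\<close>
  invertible.\<close>

lemma exists_pcompose_power_cong_X:
  fixes N q j :: nat
  assumes "coprime q N" "q > 0" 
  shows "\<exists>f :: 'a::field_char_0 poly. ([:0, 1:] ^ N - 1) ^ j dvd pcompose f ([:0, 1:] ^ q) - [:0, 1:]"
proof (induction j)
  case 0
  show ?case by simp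
next
  case (Suc j)
  define X :: "'a poly" where "X = [:0, 1:]"
  define Y where "Y = X ^ N - 1"
  define s where "s = (\<Sum>i<q. (X ^ N) ^ i)"
  define c :: 'a where "c = of_nat q ^ j"
  have c: "c \<noteq> 0" using assms by (simp add: c_def)
  obtain f h where fh: "pcompose f (X ^ q) - X = Y ^ j * h"
    using Suc by (auto simp: X_def Y_def dvd_def)
  \<comment> \<open>\<open>r\<close> is an inverse of \<open>q\<close> modulo \<open>N\<close>, so
    substituting x^r and then x^q amounts to the identity modulo \<open>Y\<close>.\<close>
  obtain r m where rm: "q * r = N * m + 1"
    using bezout_nat[of q N] assms by (auto simp: coprime_iff_gcd_eq_1)
  \<comment> \<open>Newton step: modulo \<^term>\<open>Y\<close> one has $x^{qr} = x$ and $(x^{qN} - 1)/(x^N - 1) = q$.\<close>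
  define f' where "f' = f - (X ^ N - 1) ^ j * smult (inverse c) (pcompose h (X ^ r))"
  have pX: "pcompose X g = g" for g by (simp add: X_def pcompose_pCons)
  have pw: "pcompose (X ^ k) g = g ^ k" for g k by (simp add: pcompose_power pX)
  have ZN: "(X ^ q) ^ N - 1 = Y * s"
    using power_diff_1_eq[of "X ^ N" q]
    by (simp add: Y_def s_def power_mult[symmetric] mult.commute)
  \<comment> \<open>Each of the \<open>q\<close> summands of \<open>s\<close> is a power of
    \<open>X ^ N\<close>, hence 1 modulo \<open>Y\<close>.\<close>
  have "Y dvd s - of_nat q"
  proof -
    have "s - of_nat q = (\<Sum>i<q. (X ^ N) ^ i - 1 ^ i)"
      by (simp add: s_def sum_subtractf)
    also have "Y dvd \<dots>" unfolding Y_def by (rule dvd_sum) (rule diff_dvd_power_diff)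
    finally show ?thesis .
  qed
  then have sj: "Y dvd s ^ j - of_nat q ^ j"
    using diff_dvd_power_diff dvd_trans by blast
  have "Y dvd (X ^ N) ^ m - 1 ^ m" unfolding Y_def by (rule diff_dvd_power_diff)
  then have "Y dvd X * ((X ^ N) ^ m - 1)" by simp
  also have "X * ((X ^ N) ^ m - 1) = X ^ (q * r) - X"
    by (simp add: rm power_mult[symmetric] algebra_simps)
  also have "\<dots> dvd pcompose h (X ^ (q * r)) - pcompose h X"
    by (rule diff_dvd_pcompose_diff)
  finally have hh: "Y dvd pcompose h (X ^ (q * r)) - h" by (simp add: X_def)
  have "pcompose f' (X ^ q) - X
      = Y ^ j * (h - s ^ j * smult (inverse c) (pcompose h (X ^ (q * r))))"
  proof -
    have "pcompose f' (X ^ q) - X = (pcompose f (X ^ q) - X)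
        - ((X ^ q) ^ N - 1) ^ j * smult (inverse c) (pcompose h (X ^ (q * r)))"
      by (simp add: f'_def pcompose_diff pcompose_mult pcompose_power pcompose_1 pw pcompose_smult
          pX power_mult flip: pcompose_assoc)
    then show ?thesis by (simp add: fh ZN power_mult_distrib algebra_simps)
  qed
  moreover have "Y dvd h - s ^ j * smult (inverse c) (pcompose h (X ^ (q * r)))"
  proof -
    have h: "h = smult (inverse c) (of_nat q ^ j * h)"
    proof -
      have "of_nat q ^ j = [:c:]" unfolding c_def
        by (induction j) (auto simp: of_nat_poly one_pCons)
      then show ?thesis using c by simp
    qed
    \<comment> \<open>Two replacements modulo \<open>Y\<close>: first \<open>s ^ j\<close> by
      \<open>q ^ j\<close>, which cancels against \<open>c\<close>, then h(x^(qr)) by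
      \<open>h\<close>.\<close>
    have "h - s ^ j * smult (inverse c) (pcompose h (X ^ (q * r))) =
      smult (- inverse c) ((s ^ j - of_nat q ^ j) * pcompose h (X ^ (q * r))
         + of_nat q ^ j * (pcompose h (X ^ (q * r)) - h))"
      by (subst (1) h) (simp add: algebra_simps smult_diff_right smult_add_right)
    also have "Y dvd \<dots>" using sj hh by (intro dvd_smult dvd_add) auto
    finally show ?thesis .
  qed
  ultimately have "Y ^ Suc j dvd pcompose f' (X ^ q) - X"
    by (simp add: mult_dvd_mono mult.commute[of Y])
  then show ?case unfolding X_def Y_def by blast
qed

section \<open>Roots of unity from power images\<close>

text \<open>Write z^(P^k) = y_k^(Q^k) with y_k in \<open>S\<close>. Finiteness forces y_k = y_l for
  some k < l = k + d, and comparing the two equations gives z^(P^k Q^d) = z^(P^k P^d). The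
  difference of these exponents is the required \<open>N\<close> up to sign.\<close>

lemma root_of_unity_coprime:
  fixes S :: "'a::idom set" and P Q :: nat
  assumes "finite S" "0 \<notin> S" "coprime P Q" "P > 0" "Q > 0" "P \<noteq> Q" "z \<in> S"
    and im: "\<And>k. (\<lambda>x. x ^ (P ^ k)) ` S = (\<lambda>x. x ^ (Q ^ k)) ` S"
  shows "\<exists>N>0. coprime N Q \<and> z ^ N = 1"
proof -
  have "\<forall>k. \<exists>y\<in>S. z ^ (P ^ k) = y ^ (Q ^ k)" using im \<open>z \<in> S\<close> by blast
  then obtain y where y: "\<And>k. y k \<in> S" "\<And>k. z ^ (P ^ k) = y k ^ (Q ^ k)" by metis
  have "\<not> inj y"
    using y(1) \<open>finite S\<close> finite_subset[of "range y" S] range_inj_infinite by blast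
  then obtain k l where kl: "k < l" "y k = y l"
    unfolding inj_def by (metis linorder_neqE_nat)
  define d where "d = l - k"
  have d: "d > 0" "l = k + d" using kl by (auto simp: d_def)
  \<comment> \<open>Both sides equal y_k^(Q^l), since y_k = y_l.\<close>
  have eq: "z ^ (P ^ k * Q ^ d) = z ^ (P ^ k * P ^ d)"
    by (metis d(2) kl(2) power_add power_mult y(2))
  have cancel: "z ^ (a - b) = 1" if "z ^ a = z ^ b" "b < a" for a b :: nat
  proof -
    have "z ^ b * z ^ (a - b) = z ^ b * 1"
      using that by (simp flip: power_add)
    moreover have "z \<noteq> 0" using assms by auto
    ultimately show ?thesis by simp
  qed
  have "P ^ d \<noteq> Q ^ d" using d(1) assms(6) by (auto dest: power_eq_imp_eq_base)
  then consider "Q ^ d < P ^ d" | "P ^ d < Q ^ d" by linarith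
  then show ?thesis
  proof cases
    case 1
    \<comment> \<open>As d > 0, a divisor of \<open>Q\<close> divides \<open>Q ^ d\<close>; if it
      also divides the difference, it divides \<open>P ^ d\<close>, which is coprime to
      \<open>Q\<close>.\<close>
    have "coprime (P ^ d - Q ^ d) Q"
    proof (rule coprimeI)
      fix e assume e: "e dvd P ^ d - Q ^ d" "e dvd Q"
      then have "e dvd Q ^ d" using d(1) by (auto intro: dvd_trans dvd_power)
      then have "e dvd P ^ d" using e(1) 1 by (auto intro: dvd_diffD)
      with e show "is_unit e" using coprime_common_divisor[of "P ^ d" Q e] assms by auto
    qed
    with 1 show ?thesis
      using cancel[OF eq[symmetric]] assms
      by (intro exI[of _ "P ^ k * P ^ d - P ^ k * Q ^ d"])
        (auto simp flip: diff_mult_distrib2)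
  next
    case 2
    have "coprime (Q ^ d - P ^ d) Q"
    proof (rule coprimeI)
      fix e assume e: "e dvd Q ^ d - P ^ d" "e dvd Q"
      then have "e dvd Q ^ d" using d(1) by (auto intro: dvd_trans dvd_power)
      then have "e dvd P ^ d" using e(1) 2 by (auto intro: dvd_diffD1)
      with e show "is_unit e" using coprime_common_divisor[of "P ^ d" Q e] assms by auto
    qed
    with 2 show ?thesis
      using cancel[OF eq] assms
      by (intro exI[of _ "P ^ k * Q ^ d - P ^ k * P ^ d"])
        (auto simp flip: diff_mult_distrib2)
  qed
qed

section \<open>Evaluation of polynomials at matrices\<close>

text \<open>Replaces the ring-theoretic \<open>finsum\<close> by complex sums of entries, on which
  the algebraic laws of evaluation are checked.\<close>

lemma eval_poly_mat_carrier_index: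
  assumes X: "X \<in> carrier_mat n n"
  shows "eval_poly_mat f X \<in> carrier_mat n n"
    and "i < n \<Longrightarrow> j < n \<Longrightarrow>
      eval_poly_mat f X $$ (i, j) = (\<Sum>k\<le>degree f. coeff f k * (X ^\<^sub>m k) $$ (i, j))"
proof -
  define R where "R = ring_mat TYPE(complex) n ()"
  interpret ring R unfolding R_def by (rule ring_mat)
  have carrier: "carrier R = carrier_mat n n" by (simp add: R_def ring_mat_simps)
  \<comment> \<open>Membership in the carrier is proved along with the entries, because the
    dimensions of the partial sum are needed to read off the entries of the next one.\<close>
  have sum: "finsum R F K \<in> carrier_mat n n \<and>
      (i < n \<longrightarrow> j < n \<longrightarrow> finsum R F K $$ (i, j) = (\<Sum>k\<in>K. F k $$ (i, j)))"
    if "finite K" "\<And>k. F k \<in> carrier_mat n n" for K :: "nat set" and i j F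
    using that
  proof (induction K)
    case empty
    show ?case using zero_closed by (simp add: carrier) (simp add: R_def ring_mat_simps)
  next
    case (insert k K)
    then have "finsum R F (insert k K) = F k + finsum R F K"
      by (subst finsum_insert) (auto simp: carrier R_def ring_mat_simps)
    with insert show ?case by auto
  qed
  have dim: "dim_row X = n" using X by auto
  have c: "coeff f k \<cdot>\<^sub>m (X ^\<^sub>m k) \<in> carrier_mat n n" for k using X by simp
  show "eval_poly_mat f X \<in> carrier_mat n n"
    unfolding eval_poly_mat_def dim R_def[symmetric] using sum[OF _ c] by simp
  show "eval_poly_mat f X $$ (i, j) = (\<Sum>k\<le>degree f. coeff f k * (X ^\<^sub>m k) $$ (i, j))"
    if "i < n" "j < n"
    unfolding eval_poly_mat_def dim R_def[symmetric]
    using sum[OF _ c, THEN conjunct2, rule_format, OF _ that] that X by simp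
qed

lemmas eval_poly_mat_carrier[simp] = eval_poly_mat_carrier_index(1)

text \<open>The free bound \<open>d\<close> allows polynomials of different degrees to be summed
  over one common range.\<close>

lemma eval_poly_mat_index:
  assumes "X \<in> carrier_mat n n" "i < n" "j < n" "degree f \<le> d"
  shows "eval_poly_mat f X $$ (i, j) = (\<Sum>k\<le>d. coeff f k * (X ^\<^sub>m k) $$ (i, j))"
  unfolding eval_poly_mat_carrier_index(2)[OF assms(1-3)]
  by (rule sum.mono_neutral_left) (use assms(4) in \<open>auto simp: coeff_eq_0 not_le\<close>)

text \<open>Powers recurse with the new factor on the right; the Horner rule takes it out on the
  left.\<close>

lemma pow_mat_Suc_left:
  assumes "X \<in> carrier_mat n n"
  shows "X ^\<^sub>m Suc k = X * X ^\<^sub>m k"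
proof (induction k)
  case (Suc k)
  then have "X ^\<^sub>m Suc (Suc k) = X * X ^\<^sub>m k * X" by simp
  also have "\<dots> = X * (X ^\<^sub>m k * X)" using assms by (intro assoc_mult_mat) auto
  finally show ?case by simp
qed (use assms in auto)

lemma eval_poly_mat_0: "X \<in> carrier_mat n n \<Longrightarrow> eval_poly_mat 0 X = 0\<^sub>m n n"
  by (rule eq_matI) (auto simp: eval_poly_mat_index[where d = 0] carrier_matD[OF eval_poly_mat_carrier])

text \<open>Horner's rule, which reduces later facts about evaluation to induction over
  \<open>pCons\<close>.\<close>

lemma eval_poly_mat_pCons:
  assumes X: "X \<in> carrier_mat n n"
  shows "eval_poly_mat (pCons a f) X = a \<cdot>\<^sub>m 1\<^sub>m n + X * eval_poly_mat f X"
proof (rule eq_matI)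
  note carr = carrier_matD[OF eval_poly_mat_carrier[OF X]] carrier_matD[OF X]
  fix i j assume "i < dim_row (a \<cdot>\<^sub>m 1\<^sub>m n + X * eval_poly_mat f X)"
    "j < dim_col (a \<cdot>\<^sub>m 1\<^sub>m n + X * eval_poly_mat f X)"
  then have ij: "i < n" "j < n" by (auto simp: carr)
  have prod: "(X * M) $$ (i, j) = (\<Sum>l<n. X $$ (i, l) * M $$ (l, j))"
    if "M \<in> carrier_mat n n" for M
    using that X ij by (auto simp: scalar_prod_def atLeast0LessThan)
  have "eval_poly_mat (pCons a f) X $$ (i, j)
      = (\<Sum>k\<le>Suc (degree f). coeff (pCons a f) k * (X ^\<^sub>m k) $$ (i, j))"
    by (rule eval_poly_mat_index[OF X ij degree_pCons_le])
  also have "\<dots> = a * 1\<^sub>m n $$ (i, j) + (\<Sum>k\<le>degree f. coeff f k * (X * X ^\<^sub>m k) $$ (i, j))"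
    unfolding sum.atMost_Suc_shift
    by (simp add: carr pow_mat_Suc_left[OF X] del: pow_mat.simps(2))
  also have "(\<Sum>k\<le>degree f. coeff f k * (X * X ^\<^sub>m k) $$ (i, j))
      = (\<Sum>k\<le>degree f. \<Sum>l<n. X $$ (i, l) * (coeff f k * (X ^\<^sub>m k) $$ (l, j)))"
    using X by (simp add: prod sum_distrib_left mult_ac)
  also have "\<dots> = (\<Sum>l<n. X $$ (i, l) * eval_poly_mat f X $$ (l, j))"
    unfolding sum_distrib_left[symmetric]
    by (subst sum.swap) (simp add: eval_poly_mat_index[OF X _ ij(2) order_refl] sum_distrib_left)
  also have "\<dots> = (X * eval_poly_mat f X) $$ (i, j)"
    by (simp add: prod X)
  finally show "eval_poly_mat (pCons a f) X $$ (i, j) = (a \<cdot>\<^sub>m 1\<^sub>m n + X * eval_poly_mat f X) $$ (i, j)"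
    using ij by (simp add: carr)
qed (auto simp: carrier_matD[OF eval_poly_mat_carrier[OF X]] carrier_matD[OF X])

lemma eval_poly_mat_const:
  "X \<in> carrier_mat n n \<Longrightarrow> eval_poly_mat [:a:] X = a \<cdot>\<^sub>m 1\<^sub>m n"
  by (simp add: eval_poly_mat_pCons[of _ n] eval_poly_mat_0[of _ n])

lemma eval_poly_mat_1: "X \<in> carrier_mat n n \<Longrightarrow> eval_poly_mat 1 X = 1\<^sub>m n"
  unfolding one_pCons by (subst eval_poly_mat_const) (auto intro!: eq_matI)

lemma eval_poly_mat_X: "X \<in> carrier_mat n n \<Longrightarrow> eval_poly_mat [:0, 1:] X = X"
  by (auto simp: eval_poly_mat_pCons[of _ n] eval_poly_mat_0[of _ n] intro!: eq_matI)

lemma eval_poly_mat_add: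
  assumes X: "X \<in> carrier_mat n n"
  shows "eval_poly_mat (f + g) X = eval_poly_mat f X + eval_poly_mat g X"
proof -
  have d: "degree (f + g) \<le> max (degree f) (degree g)" by (rule degree_add_le_max)
  note index = eval_poly_mat_index[OF X, where d = "max (degree f) (degree g)"]
  show ?thesis
    by (rule eq_matI) (use d in \<open>auto simp: carrier_matD[OF eval_poly_mat_carrier[OF X]]
      index algebra_simps sum.distrib\<close>)
qed

lemma eval_poly_mat_smult:
  assumes X: "X \<in> carrier_mat n n"
  shows "eval_poly_mat (smult c f) X = c \<cdot>\<^sub>m eval_poly_mat f X"
  by (rule eq_matI) (auto simp: carrier_matD[OF eval_poly_mat_carrier[OF X]]
      eval_poly_mat_index[OF X, where d = "degree f"] sum_distrib_left mult_ac)

lemma eval_poly_mat_mult: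
  assumes X: "X \<in> carrier_mat n n"
  shows "eval_poly_mat (f * g) X = eval_poly_mat f X * eval_poly_mat g X"
proof (induction f)
  case 0
  show ?case
    by (simp add: eval_poly_mat_0[OF X] left_mult_zero_mat[OF eval_poly_mat_carrier[OF X]])
next
  case (pCons a f)
  define F G where "F = eval_poly_mat f X" and "G = eval_poly_mat g X"
  have FG: "F \<in> carrier_mat n n" "G \<in> carrier_mat n n" using X by (auto simp: F_def G_def)
  have "eval_poly_mat (pCons a f * g) X = a \<cdot>\<^sub>m G + (0 \<cdot>\<^sub>m 1\<^sub>m n + X * (F * G))"
    by (simp add: eval_poly_mat_add[OF X] eval_poly_mat_smult[OF X] eval_poly_mat_pCons[OF X]
        pCons.IH F_def G_def)
  also have "\<dots> = a \<cdot>\<^sub>m G + X * F * G"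
    using X FG by (auto simp: assoc_mult_mat[of _ n n _ n _ n] intro!: eq_matI)
  also have "\<dots> = (a \<cdot>\<^sub>m 1\<^sub>m n) * G + X * F * G"
    by (simp add: mult_smult_assoc_mat[OF one_carrier_mat FG(2)] left_mult_one_mat[OF FG(2)])
  also have "\<dots> = (a \<cdot>\<^sub>m 1\<^sub>m n + X * F) * G"
    using X FG by (intro add_mult_distrib_mat[symmetric]) auto
  finally show ?case by (simp add: eval_poly_mat_pCons[OF X] F_def G_def)
qed

lemma eval_poly_mat_power:
  assumes X: "X \<in> carrier_mat n n"
  shows "eval_poly_mat (f ^ k) X = eval_poly_mat f X ^\<^sub>m k"
proof (induction k)
  case 0
  show ?case by (simp add: eval_poly_mat_1[OF X] carrier_matD[OF eval_poly_mat_carrier[OF X]])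
next
  case (Suc k)
  have "eval_poly_mat (f ^ Suc k) X = eval_poly_mat (f ^ k * f) X" by (simp add: mult.commute)
  with Suc show ?case by (simp add: eval_poly_mat_mult[OF X])
qed

lemma eval_poly_mat_pcompose:
  assumes X: "X \<in> carrier_mat n n"
  shows "eval_poly_mat (pcompose f g) X = eval_poly_mat f (eval_poly_mat g X)"
  by (induction f) (simp_all add: X eval_poly_mat_0[of _ n] pcompose_pCons eval_poly_mat_add[OF X]
      eval_poly_mat_mult[OF X] eval_poly_mat_const[OF X] eval_poly_mat_pCons[of _ n])

text \<open>Serves two purposes: for invertible \<open>C\<close> it transports polynomials along a
  conjugation, and for \<open>X = Y\<close> it says that whatever commutes with \<open>X\<close>
  commutes with every polynomial in \<open>X\<close>.\<close>

lemma eval_poly_mat_intertwine: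
  assumes X: "X \<in> carrier_mat n n" and Y: "Y \<in> carrier_mat n n" and C: "C \<in> carrier_mat n n"
    and XC: "X * C = C * Y"
  shows "eval_poly_mat f X * C = C * eval_poly_mat f Y"
proof (induction f)
  case 0
  show ?case using C by (simp add: eval_poly_mat_0[OF X] eval_poly_mat_0[OF Y])
next
  case (pCons a f)
  define F G where "F = eval_poly_mat f X" and "G = eval_poly_mat f Y"
  have FG: "F \<in> carrier_mat n n" "G \<in> carrier_mat n n" using X Y by (auto simp: F_def G_def)
  have IH: "F * C = C * G" using pCons.IH by (simp add: F_def G_def)
  have "X * F * C = X * (C * G)"
    unfolding IH[symmetric] by (rule assoc_mult_mat[OF X FG(1) C])
  also have "\<dots> = X * C * G" by (rule assoc_mult_mat[symmetric, OF X C FG(2)])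
  also have "\<dots> = C * (Y * G)" unfolding XC by (rule assoc_mult_mat[OF C Y FG(2)])
  finally have *: "X * F * C = C * (Y * G)" .
  have aI: "a \<cdot>\<^sub>m 1\<^sub>m n \<in> carrier_mat n n" by simp
  have "(a \<cdot>\<^sub>m 1\<^sub>m n + X * F) * C = (a \<cdot>\<^sub>m 1\<^sub>m n) * C + X * F * C"
    by (rule add_mult_distrib_mat[OF aI mult_carrier_mat[OF X FG(1)] C])
  also have "(a \<cdot>\<^sub>m 1\<^sub>m n) * C = C * (a \<cdot>\<^sub>m 1\<^sub>m n)"
    by (simp add: mult_smult_assoc_mat[OF one_carrier_mat C] mult_smult_distrib[OF C one_carrier_mat]
        left_mult_one_mat[OF C] right_mult_one_mat[OF C])
  also have "C * (a \<cdot>\<^sub>m 1\<^sub>m n) + X * F * C = C * (a \<cdot>\<^sub>m 1\<^sub>m n + Y * G)"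
    unfolding * by (rule mult_add_distrib_mat[symmetric, OF C aI mult_carrier_mat[OF Y FG(2)]])
  finally show ?case
    by (simp add: eval_poly_mat_pCons[OF X] eval_poly_mat_pCons[OF Y] F_def G_def)
qed

section \<open>Triangular matrices\<close>

lemma upper_triangular_pow:
  fixes T :: "'a::comm_semiring_1 mat"
  assumes T: "T \<in> carrier_mat n n" "upper_triangular T"
  shows "upper_triangular (T ^\<^sub>m k) \<and> (\<forall>i<n. (T ^\<^sub>m k) $$ (i, i) = T $$ (i, i) ^ k)"
proof (induction k)
  case 0
  then show ?case using T by auto
next
  case (Suc k)
  have prod: "(T ^\<^sub>m Suc k) $$ (i, j) = (\<Sum>l<n. (T ^\<^sub>m k) $$ (i, l) * T $$ (l, j))"
    if "i < n" "j < n" for i j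
    using that T by (auto simp: scalar_prod_def atLeast0LessThan)
  \<comment> \<open>Below the diagonal every term of the product sum vanishes, and on the diagonal
    only \<open>l = i\<close> survives.\<close>
  have zero: "(T ^\<^sub>m k) $$ (i, l) * T $$ (l, j) = 0" if "j < i \<or> j = i \<and> l \<noteq> i" "i < n" "l < n" for i j l
  proof (cases "l < i")
    case True
    then have "(T ^\<^sub>m k) $$ (i, l) = 0" using Suc that T by (intro upper_triangularD) auto
    then show ?thesis by simp
  next
    case False
    then have "T $$ (l, j) = 0" using that T by (intro upper_triangularD) auto
    then show ?thesis by simp
  qed
  have "upper_triangular (T ^\<^sub>m Suc k)"
  proof
    fix i j assume "j < i" "i < dim_row (T ^\<^sub>m Suc k)"
    then show "(T ^\<^sub>m Suc k) $$ (i, j) = 0"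
      using T zero by (subst prod) (auto intro!: sum.neutral)
  qed
  moreover have "(T ^\<^sub>m Suc k) $$ (i, i) = T $$ (i, i) ^ Suc k" if "i < n" for i
  proof -
    have "(T ^\<^sub>m Suc k) $$ (i, i) = (\<Sum>l\<in>{i}. (T ^\<^sub>m k) $$ (i, l) * T $$ (l, i))"
      unfolding prod[OF that that]
      by (rule sum.mono_neutral_right) (use zero that in auto)
    then show ?thesis using Suc that by (simp add: mult.commute)
  qed
  ultimately show ?case by blast
qed

text \<open>Each further factor \<open>T\<close> pushes the possibly nonzero entries one diagonal
  up: those of the k-th power satisfy j >= i + k. At k = n none remain.\<close>

lemma strictly_upper_triangular_nilpotent:
  assumes T: "T \<in> carrier_mat n n" and zero: "\<And>i j. j \<le> i \<Longrightarrow> i < n \<Longrightarrow> T $$ (i, j) = 0"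
  shows "T ^\<^sub>m n = 0\<^sub>m n n"
proof -
  have "(T ^\<^sub>m k) $$ (i, j) = 0" if "i < n" "j < n" "j < i + k" for i j k
    using that
  proof (induction k arbitrary: j)
    case 0
    then show ?case using T by simp
  next
    case (Suc k)
    have "(T ^\<^sub>m Suc k) $$ (i, j) = (\<Sum>l<n. (T ^\<^sub>m k) $$ (i, l) * T $$ (l, j))"
      using Suc.prems T by (auto simp: scalar_prod_def atLeast0LessThan)
    also have "\<dots> = 0"
    proof (rule sum.neutral, rule ballI)
      fix l assume "l \<in> {..<n}"
      then show "(T ^\<^sub>m k) $$ (i, l) * T $$ (l, j) = 0"
        \<comment> \<open>If l < i + k the left factor vanishes by induction; otherwise j <= l and
          the right factor vanishes.\<close>
        using Suc zero[of j l] by (cases "l < i + k") auto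
    qed
    finally show ?case .
  qed
  then show ?thesis using T by (intro eq_matI) auto
qed

section \<open>Schur form, eigenvalues of powers and annihilating polynomials\<close>

lemma complex_schur_exists:
  fixes A :: "complex mat"
  assumes A: "A \<in> carrier_mat n n"
  obtains T where "T \<in> carrier_mat n n" "upper_triangular T" "similar_mat A T"
proof -
  obtain as where "char_poly A = (\<Prod>a\<leftarrow>as. [:- a, 1:])" using char_poly_factorized[OF A] by blast
  then show ?thesis using schur_decomposition_exists[OF A] that by blast
qed

lemma similar_mat_pow: "similar_mat A B \<Longrightarrow> similar_mat (A ^\<^sub>m k) (B ^\<^sub>m k)"
  unfolding similar_mat_def using similar_mat_wit_pow by blast

text \<open>Similarity of two powers of \<open>A\<close> thereby becomes an equality of two power
  images of one finite set, the diagonal of \<open>T\<close>.\<close>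

lemma char_poly_pow_roots:
  fixes A :: "complex mat"
  assumes T: "T \<in> carrier_mat n n" "upper_triangular T" and sim: "similar_mat A T"
  shows "{x. poly (char_poly (A ^\<^sub>m k)) x = 0} = (\<lambda>x. x ^ k) ` set (diag_mat T)"
proof -
  have "char_poly (A ^\<^sub>m k) = char_poly (T ^\<^sub>m k)"
    by (intro char_poly_similar similar_mat_pow sim)
  also have "\<dots> = (\<Prod>a\<leftarrow>diag_mat (T ^\<^sub>m k). [:- a, 1:])"
    using T upper_triangular_pow[OF T] by (intro char_poly_upper_triangular) auto
  also have "diag_mat (T ^\<^sub>m k) = map (\<lambda>x. x ^ k) (diag_mat T)"
    using T upper_triangular_pow[OF T, of k] by (auto simp: diag_mat_def)
  finally show ?thesis
    by (auto simp: poly_prod_list o_def prod_list_zero_iff)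
qed

lemma eval_poly_mat_X_power_minus_1:
  assumes X: "X \<in> carrier_mat n n"
  shows "eval_poly_mat ([:0, 1:] ^ N - 1) X = X ^\<^sub>m N - 1\<^sub>m n"
proof -
  \<comment> \<open>The difference is written as a sum so that the rules for addition and scaling
    apply.\<close>
  have "eval_poly_mat ([:0, 1:] ^ N - 1) X = eval_poly_mat ([:0, 1:] ^ N + smult (-1) 1) X"
    by (simp only: smult_minus_left smult_1_left add_uminus_conv_diff)
  also have "\<dots> = X ^\<^sub>m N + (-1) \<cdot>\<^sub>m 1\<^sub>m n"
    by (simp only: eval_poly_mat_add[OF X] eval_poly_mat_smult[OF X] eval_poly_mat_power[OF X]
        eval_poly_mat_X[OF X] eval_poly_mat_1[OF X])
  finally show ?thesis using X by (auto intro!: eq_matI)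
qed

lemma eval_poly_mat_similar:
  assumes "similar_mat_wit A T P Q" "A \<in> carrier_mat n n"
  shows "eval_poly_mat f A = P * eval_poly_mat f T * Q"
proof -
  note w = similar_mat_witD2[OF assms(2,1)]
  have "A * P = P * T" 
    using w by (simp add: assoc_mult_mat[of _ n n _ n _ n])
  then have "eval_poly_mat f A * P = P * eval_poly_mat f T"
    using w by (intro eval_poly_mat_intertwine)
  then have "eval_poly_mat f A * P * Q = P * eval_poly_mat f T * Q" by simp
  also have "eval_poly_mat f A * P * Q = eval_poly_mat f A * (P * Q)"
    by (rule assoc_mult_mat[OF eval_poly_mat_carrier[OF assms(2)] w(6,7)])
  also have "\<dots> = eval_poly_mat f A"
    by (simp add: w(1) right_mult_one_mat[OF eval_poly_mat_carrier[OF assms(2)]])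
  finally show ?thesis .
qed

text \<open>The diagonal of \<open>T ^\<^sub>m N\<close> consists of ones, so subtracting the
  identity leaves a strictly upper triangular matrix, whose n-th power is zero. Similarity carries
  this over to \<open>A\<close>.\<close>

lemma eval_X_power_minus_1_eq_0:
  fixes A :: "complex mat"
  assumes A: "A \<in> carrier_mat n n" and T: "T \<in> carrier_mat n n" "upper_triangular T"
    and sim: "similar_mat A T" and root: "\<And>x. x \<in> set (diag_mat T) \<Longrightarrow> x ^ N = 1"
  shows "eval_poly_mat (([:0, 1:] ^ N - 1) ^ n) A = 0\<^sub>m n n"
proof -
  obtain P Q where wit: "similar_mat_wit A T P Q" using sim by (auto simp: similar_mat_def)
  have diag: "T $$ (i, i) ^ N = 1" if "i < n" for i
    using that T by (intro root) (auto simp: diag_mat_def)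
  have "(T ^\<^sub>m N - 1\<^sub>m n) $$ (i, j) = 0" if "j \<le> i" "i < n" for i j
  proof (cases "j = i")
    case False
    then have "(T ^\<^sub>m N) $$ (i, j) = 0"
      using T that upper_triangular_pow[OF T, of N] by (intro upper_triangularD) auto
    then show ?thesis using that T False by simp
  qed (use that T diag upper_triangular_pow[OF T, of N] in auto)
  then have "(T ^\<^sub>m N - 1\<^sub>m n) ^\<^sub>m n = 0\<^sub>m n n"
    using T by (intro strictly_upper_triangular_nilpotent) (auto intro!: minus_carrier_mat)
  then have "eval_poly_mat (([:0, 1:] ^ N - 1) ^ n) T = 0\<^sub>m n n"
    by (simp only: eval_poly_mat_power[OF T(1)] eval_poly_mat_X_power_minus_1[OF T(1)])
  then show ?thesis
    using similar_mat_witD2(6,7)[OF A wit]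
    by (simp add: eval_poly_mat_similar[OF wit A] right_mult_zero_mat[of _ n n] left_mult_zero_mat[of _ n n])
qed

text \<open>Turns polynomial congruences modulo an annihilator of \<open>X\<close> into matrix
  identities.\<close>

lemma eval_poly_mat_cong_dvd:
  assumes X: "X \<in> carrier_mat n n" and "h dvd f - g" and "eval_poly_mat h X = 0\<^sub>m n n"
  shows "eval_poly_mat f X = eval_poly_mat g X"
proof -
  obtain u where "f = h * u + g" using assms(2) by (metis diff_add_cancel dvd_def)
  then show ?thesis
    using assms(3) left_add_zero_mat[OF eval_poly_mat_carrier[OF X]]
    by (simp add: eval_poly_mat_add[OF X] eval_poly_mat_mult[OF X]
        left_mult_zero_mat[OF eval_poly_mat_carrier[OF X]])
qed

section \<open>The Baumslag--Solitar relation\<close>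

lemma (in group) conj_hom:
  assumes "b \<in> carrier G"
  shows "(\<lambda>x. inv b \<otimes> x \<otimes> b) \<in> hom G G"
proof (rule homI)
  fix x y assume xy: "x \<in> carrier G" "y \<in> carrier G"
  have "b \<otimes> (inv b \<otimes> (y \<otimes> b)) = y \<otimes> b"
    using xy assms by (simp flip: m_assoc)
  then show "inv b \<otimes> (x \<otimes> y) \<otimes> b = inv b \<otimes> x \<otimes> b \<otimes> (inv b \<otimes> y \<otimes> b)"
    using xy assms by (simp add: m_assoc)
qed (use assms in auto)

lemma (in group) conj_int_pow:
  assumes "b \<in> carrier G" "x \<in> carrier G"
  shows "inv b \<otimes> x [^] (z::int) \<otimes> b = (inv b \<otimes> x \<otimes> b) [^] z"
  using hom_int_pow[OF conj_hom[OF assms(1)] assms(2) is_group is_group, of z] by simp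

text \<open>Conjugating a^(p^(k+1)) by b^k gives (a^(q^k))^p by induction. This is (a^p)^(q^k), and
  one more conjugation by b turns it into (a^q)^(q^k).\<close>

lemma (in group) Baumslag_Solitar_iterate:
  fixes p q :: int
  assumes a: "a \<in> carrier G" and b: "b \<in> carrier G"
    and rel: "inv b \<otimes> a [^] p \<otimes> b = a [^] q"
  shows "inv (b [^] k) \<otimes> a [^] (p ^ k) \<otimes> b [^] (k::nat) = a [^] (q ^ k)"
proof (induction k)
  case (Suc k)
  have bk: "b [^] k \<in> carrier G" using b by simp
  have "inv (b [^] Suc k) \<otimes> a [^] (p ^ Suc k) \<otimes> b [^] Suc k
      = inv b \<otimes> (inv (b [^] k) \<otimes> (a [^] (p ^ k)) [^] p \<otimes> b [^] k) \<otimes> b"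
    using a b by (simp add: inv_mult_group m_assoc int_pow_pow mult.commute)
  also have "\<dots> = inv b \<otimes> (a [^] (q ^ k)) [^] p \<otimes> b"
    using a bk Suc by (simp add: conj_int_pow)
  also have "(a [^] (q ^ k)) [^] p = (a [^] p) [^] (q ^ k)"
    using a by (simp add: int_pow_pow mult.commute)
  also have "inv b \<otimes> \<dots> \<otimes> b = (a [^] q) [^] (q ^ k)"
    using a b by (simp only: conj_int_pow int_pow_closed rel)
  also have "\<dots> = a [^] (q ^ Suc k)"
    using a by (simp add: int_pow_pow)
  finally show ?case .
qed (use a in auto)

section \<open>Translation between the group \<open>GL n\<close> and matrix operations\<close>

lemma GL_group: "group (GL n)"
  by (intro monoid.units_group ring.is_monoid ring_mat)

lemma GL_carrier_mat: "A \<in> carrier (GL n) \<Longrightarrow> A \<in> carrier_mat n n"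
  by (auto simp: units_of_def Units_def ring_mat_simps)

lemma GL_mult: "mult (GL n) = (*)"
  by (simp add: units_of_def ring_mat_simps)

lemma GL_one: "one (GL n) = 1\<^sub>m n"
  by (simp add: units_of_def ring_mat_simps)

lemma GL_nat_pow: "A \<in> carrier (GL n) \<Longrightarrow> A [^]\<^bsub>GL n\<^esub> (k::nat) = A ^\<^sub>m k"
  by (induction k) (use GL_carrier_mat[of A n] in \<open>auto simp: GL_mult GL_one nat_pow_def\<close>)

text \<open>The determinant of an invertible matrix is nonzero, and it is the product of the
  diagonal of \<open>T\<close>.\<close>

lemma GL_diag_mat_nonzero:
  assumes A: "A \<in> carrier (GL n)"
    and T: "T \<in> carrier_mat n n" "upper_triangular T" and sim: "similar_mat A T"
  shows "0 \<notin> set (diag_mat T)"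
proof -
  interpret group "GL n" by (rule GL_group)
  note Ac = GL_carrier_mat[OF A] GL_carrier_mat[OF inv_closed[OF A]]
  have "A * inv\<^bsub>GL n\<^esub> A = 1\<^sub>m n" using r_inv[OF A] by (simp add: GL_mult GL_one)
  then have "det A * det (inv\<^bsub>GL n\<^esub> A) = 1"
    using det_mult[OF Ac] by simp
  then have "det A \<noteq> 0" by auto
  moreover have "det A = prod_list (diag_mat T)"
    using det_similar[OF sim] det_upper_triangular[OF T(2,1)] by simp
  ultimately show ?thesis by (simp add: prod_list_zero_iff)
qed

text \<open>Squaring makes both exponents natural numbers, whatever the signs of $p$ and $q$.\<close>

lemma similar_pow_if_Baumslag_Solitar:
  fixes p q :: int
  assumes A: "A \<in> carrier (GL n)" and B: "B \<in> carrier (GL n)"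
    and rel: "inv\<^bsub>GL n\<^esub> B \<otimes>\<^bsub>GL n\<^esub> (A [^]\<^bsub>GL n\<^esub> p) \<otimes>\<^bsub>GL n\<^esub> B = A [^]\<^bsub>GL n\<^esub> q"
    and P: "int P = p ^ 2" and Q: "int Q = q ^ 2"
  shows "similar_mat (A ^\<^sub>m (Q ^ k)) (A ^\<^sub>m (P ^ k))"
proof -
  interpret group "GL n" by (rule GL_group)
  define C where "C = B [^]\<^bsub>GL n\<^esub> (2 * k)"
  have C: "C \<in> carrier (GL n)" using B by (simp add: C_def)
  have pow: "p ^ (2 * k) = int (P ^ k)" "q ^ (2 * k) = int (Q ^ k)"
    using P Q by (simp_all add: power_mult)
  have "inv\<^bsub>GL n\<^esub> C * A ^\<^sub>m (P ^ k) * C = A ^\<^sub>m (Q ^ k)"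
    using Baumslag_Solitar_iterate[OF A B rel, of "2 * k"]
    unfolding pow int_pow_int GL_nat_pow[OF A] by (simp add: GL_mult C_def)
  moreover have "inv\<^bsub>GL n\<^esub> C * C = 1\<^sub>m n" "C * inv\<^bsub>GL n\<^esub> C = 1\<^sub>m n"
    using l_inv[OF C] r_inv[OF C] by (simp_all add: GL_mult GL_one)
  ultimately show ?thesis
    using GL_carrier_mat[OF A] GL_carrier_mat[OF C] GL_carrier_mat[OF inv_closed[OF C]]
    unfolding similar_mat_def
    by (intro exI[of _ "inv\<^bsub>GL n\<^esub> C"] exI[of _ C] similar_mat_witI[of _ _ n]) auto
qed

section \<open>Recovering A from its powers\<close>

text \<open>Similar powers share their characteristic polynomial, so
  \<open>root_of_unity_coprime\<close> applies to the diagonal of a Schur form of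
  \<open>A\<close>.\<close>

lemma Baumslag_Solitar_annihilator:
  fixes p q :: int
  assumes cop: "coprime p q" and big: "\<bar>p\<bar> + \<bar>q\<bar> > 2"
    and A: "A \<in> carrier (GL n)" and B: "B \<in> carrier (GL n)"
    and rel: "inv\<^bsub>GL n\<^esub> B \<otimes>\<^bsub>GL n\<^esub> (A [^]\<^bsub>GL n\<^esub> p) \<otimes>\<^bsub>GL n\<^esub> B = A [^]\<^bsub>GL n\<^esub> q"
  obtains N where "N > 0" "coprime N (nat \<bar>q\<bar>)"
    "eval_poly_mat (([:0, 1:] ^ N - 1) ^ n) A = 0\<^sub>m n n"
proof -
  note Ac = GL_carrier_mat[OF A]
  obtain T where T: "T \<in> carrier_mat n n" "upper_triangular T" and sim: "similar_mat A T"
    using complex_schur_exists[OF Ac] by blast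
  define S where "S = set (diag_mat T)"
  define P Q where "P = nat \<bar>p\<bar> ^ 2" and "Q = nat \<bar>q\<bar> ^ 2"
  have PQ: "int P = p ^ 2" "int Q = q ^ 2" by (simp_all add: P_def Q_def)
  have nz: "p \<noteq> 0" "q \<noteq> 0" using cop big by auto
  have cop': "coprime P Q"
    using cop by (simp add: P_def Q_def flip: coprime_int_iff)
  \<comment> \<open>Equality would give |p| = |q|, and coprimality then makes both 1, against
    \<open>big\<close>.\<close>
  have "P \<noteq> Q"
  proof
    assume "P = Q"
    then have "\<bar>p\<bar> = \<bar>q\<bar>" using PQ by (metis power2_eq_iff abs_minus_cancel)
    then have "coprime p p"
      using cop by (metis coprime_abs_right_iff)
    then show False using big \<open>\<bar>p\<bar> = \<bar>q\<bar>\<close> by simp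
  qed
  have "(\<lambda>x. x ^ (P ^ k)) ` S = (\<lambda>x. x ^ (Q ^ k)) ` S" for k
    using char_poly_similar[OF similar_pow_if_Baumslag_Solitar[OF A B rel PQ, of k]]
    by (simp add: S_def flip: char_poly_pow_roots[OF T sim])
  moreover have "finite S" "0 \<notin> S" "P > 0" "Q > 0"
    using GL_diag_mat_nonzero[OF A T sim] nz by (auto simp: S_def P_def Q_def)
  ultimately have "\<forall>z\<in>S. \<exists>N>0. coprime N Q \<and> z ^ N = 1"
    using root_of_unity_coprime[OF _ _ cop' _ _ \<open>P \<noteq> Q\<close>] by blast
  then obtain N where N: "\<And>z. z \<in> S \<Longrightarrow> N z > 0 \<and> coprime (N z) Q \<and> z ^ N z = 1"
    by metis
  \<comment> \<open>The product is a common exponent for all eigenvalues and stays coprime to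
    \<open>Q\<close>.\<close>
  define M where "M = prod N S"
  have "z ^ M = 1" if "z \<in> S" for z
  proof -
    have "N z dvd M" using that \<open>finite S\<close> by (auto simp: M_def)
    then show ?thesis using N[OF that] by (auto simp: power_mult elim: dvdE)
  qed
  then have "eval_poly_mat (([:0, 1:] ^ M - 1) ^ n) A = 0\<^sub>m n n"
    using eval_X_power_minus_1_eq_0[OF Ac T sim] by (simp add: S_def)
  moreover have "M > 0" using N \<open>finite S\<close> by (auto simp: M_def intro!: prod_pos)
  moreover have "coprime M Q" using N by (auto simp: M_def intro: prod_coprime_left)
  then have "coprime M (nat \<bar>q\<bar>)" by (simp add: Q_def)
  ultimately show ?thesis using that by blast
qed

text \<open>Modulo the annihilator, x is congruent to f(x^|q|); evaluating at \<open>A\<close> gives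
  the claim. The absolute value keeps the exponent a natural number.\<close>

lemma Baumslag_Solitar_eval_poly_abs:
  fixes p q :: int
  assumes cop: "coprime p q" and big: "\<bar>p\<bar> + \<bar>q\<bar> > 2"
    and A: "A \<in> carrier (GL n)" and B: "B \<in> carrier (GL n)"
    and rel: "inv\<^bsub>GL n\<^esub> B \<otimes>\<^bsub>GL n\<^esub> (A [^]\<^bsub>GL n\<^esub> p) \<otimes>\<^bsub>GL n\<^esub> B = A [^]\<^bsub>GL n\<^esub> q"
  shows "\<exists>f. A = eval_poly_mat f (A ^\<^sub>m nat \<bar>q\<bar>)"
proof -
  note Ac = GL_carrier_mat[OF A]
  obtain N where N: "coprime N (nat \<bar>q\<bar>)"
    and ann: "eval_poly_mat (([:0, 1:] ^ N - 1) ^ n) A = 0\<^sub>m n n"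
    using Baumslag_Solitar_annihilator[OF assms] by blast
  have "nat \<bar>q\<bar> > 0" using cop big by auto
  then obtain f :: "complex poly"
    where "([:0, 1:] ^ N - 1) ^ n dvd pcompose f ([:0, 1:] ^ nat \<bar>q\<bar>) - [:0, 1:]"
    using exists_pcompose_power_cong_X[of "nat \<bar>q\<bar>" N n] N by (auto simp: coprime_commute)
  from eval_poly_mat_cong_dvd[OF Ac this ann] have "A = eval_poly_mat f (A ^\<^sub>m nat \<bar>q\<bar>)"
    by (simp add: eval_poly_mat_pcompose[OF Ac] eval_poly_mat_power[OF Ac] eval_poly_mat_X[OF Ac])
  then show ?thesis by blast
qed

text \<open>For N > 0 the constant term of x^N - 1 is nonzero, so x is invertible modulo the
  annihilator.\<close>

lemma exists_poly_inverse_mat: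
  assumes X: "X \<in> carrier_mat n n" and "N > 0"
    and ann: "eval_poly_mat (([:0, 1:] ^ N - 1) ^ n) X = 0\<^sub>m n n"
  shows "\<exists>g. X * eval_poly_mat g X = 1\<^sub>m n"
proof -
  define Y :: "complex poly" where "Y = [:0, 1:] ^ N - 1"
  \<comment> \<open>\<open>- Y\<close> takes the value 1 at 0, so 1 - (-Y)^n is a multiple x g of x,
    and x g is 1 modulo \<open>Y ^ n\<close>.\<close>
  have "poly (1 - (- Y) ^ n) 0 = 0" using \<open>N > 0\<close> by (simp add: Y_def power_0_left)
  then have "[:0, 1:] dvd 1 - (- Y) ^ n" by (simp only: poly_eq_0_iff_dvd minus_zero)
  then obtain g where g: "1 - (- Y) ^ n = [:0, 1:] * g" by (rule dvdE)
  have "Y ^ n dvd [:0, 1:] * g - 1"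
    unfolding g[symmetric] by (simp add: power_minus[of Y])
  from eval_poly_mat_cong_dvd[OF X this] ann have "eval_poly_mat ([:0, 1:] * g) X = 1\<^sub>m n"
    unfolding Y_def eval_poly_mat_1[OF X] by blast
  then show ?thesis unfolding eval_poly_mat_mult[OF X] eval_poly_mat_X[OF X] by blast
qed

text \<open>For q < 0 the inverse \<open>A'\<close> satisfies the same relation and its |q|-th power
  is A^q. So \<open>A'\<close> is a polynomial in A^q, and \<open>A\<close> is a polynomial in
  \<open>A'\<close>.\<close>

lemma Baumslag_Solitar_polynomial_in:
  fixes p q :: int
  assumes cop: "coprime p q" and big: "\<bar>p\<bar> + \<bar>q\<bar> > 2"
    and A: "A \<in> carrier (GL n)" and B: "B \<in> carrier (GL n)"
    and rel: "inv\<^bsub>GL n\<^esub> B \<otimes>\<^bsub>GL n\<^esub> (A [^]\<^bsub>GL n\<^esub> p) \<otimes>\<^bsub>GL n\<^esub> B = A [^]\<^bsub>GL n\<^esub> q"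
  shows "\<exists>f. A = eval_poly_mat f (A [^]\<^bsub>GL n\<^esub> q)"
proof (cases "q \<ge> 0")
  case True
  then have "A [^]\<^bsub>GL n\<^esub> q = A ^\<^sub>m nat \<bar>q\<bar>"
    using GL_nat_pow[OF A, of "nat q"] int_pow_int[of "GL n" A "nat q"] by simp
  then show ?thesis using Baumslag_Solitar_eval_poly_abs[OF assms] by simp
next
  case False
  interpret group "GL n" by (rule GL_group)
  define A' where "A' = inv\<^bsub>GL n\<^esub> A"
  have A': "A' \<in> carrier (GL n)" using A by (simp add: A'_def)
  note A'c = GL_carrier_mat[OF A']
  \<comment> \<open>With this, \<open>rel'\<close> is \<open>rel\<close> raised to the power
    -1.\<close>
  have pow: "A' [^]\<^bsub>GL n\<^esub> z = (A [^]\<^bsub>GL n\<^esub> z) [^]\<^bsub>GL n\<^esub> (-1::int)" for z :: int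
    using A by (simp add: A'_def int_pow_inv int_pow_neg)
  have rel': "inv\<^bsub>GL n\<^esub> B \<otimes>\<^bsub>GL n\<^esub> (A' [^]\<^bsub>GL n\<^esub> p) \<otimes>\<^bsub>GL n\<^esub> B = A' [^]\<^bsub>GL n\<^esub> q"
    unfolding pow using A B by (simp only: conj_int_pow int_pow_closed rel)
  have "A' ^\<^sub>m nat \<bar>q\<bar> = A' [^]\<^bsub>GL n\<^esub> (- q)"
    using GL_nat_pow[OF A', of "nat (- q)"] int_pow_int[of "GL n" A' "nat (- q)"] False by simp
  also have "\<dots> = A [^]\<^bsub>GL n\<^esub> q"
    using A by (simp add: A'_def int_pow_inv int_pow_neg)
  finally obtain f where f: "A' = eval_poly_mat f (A [^]\<^bsub>GL n\<^esub> q)"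
    using Baumslag_Solitar_eval_poly_abs[OF cop big A' B rel'] by auto
  obtain N where "N > 0" "eval_poly_mat (([:0, 1:] ^ N - 1) ^ n) A' = 0\<^sub>m n n"
    using Baumslag_Solitar_annihilator[OF cop big A' B rel'] by blast
  then obtain g where g: "A' * eval_poly_mat g A' = 1\<^sub>m n"
    using exists_poly_inverse_mat[OF A'c] by blast
  \<comment> \<open>Multiplying A' g(A') = 1 by \<open>A\<close> on the left identifies
    \<open>A\<close> with g(A').\<close>
  have "A * (A' * eval_poly_mat g A') = A * A' * eval_poly_mat g A'"
    by (rule assoc_mult_mat[symmetric, OF GL_carrier_mat[OF A] A'c eval_poly_mat_carrier[OF A'c]])
  moreover have "A * A' = 1\<^sub>m n" using r_inv[OF A] by (simp add: A'_def GL_mult GL_one)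
  ultimately have "A = eval_poly_mat g A'"
    using g GL_carrier_mat[OF A] by (simp add: left_mult_one_mat[OF eval_poly_mat_carrier[OF A'c]])
  also have "\<dots> = eval_poly_mat (pcompose g f) (A [^]\<^bsub>GL n\<^esub> q)"
    by (simp add: f eval_poly_mat_pcompose[OF GL_carrier_mat[OF int_pow_closed[OF A]]])
  finally show ?thesis by blast
qed

theorem proposition2:
  fixes p q :: int and n :: nat and A B :: "complex mat"
  assumes "coprime p q" and "\<bar>p\<bar> + \<bar>q\<bar> > 2" and "n \<ge> 1"
    and "A \<in> carrier (GL n)" and "B \<in> carrier (GL n)"
    and "inv\<^bsub>GL n\<^esub> B \<otimes>\<^bsub>GL n\<^esub> (A [^]\<^bsub>GL n\<^esub> p) \<otimes>\<^bsub>GL n\<^esub> B = A [^]\<^bsub>GL n\<^esub> q"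
  shows "(polynomial_in A (A [^]\<^bsub>GL n\<^esub> q) \<or> polynomial_in A (A [^]\<^bsub>GL n\<^esub> p))
    \<and> (inv\<^bsub>GL n\<^esub> B \<otimes>\<^bsub>GL n\<^esub> A \<otimes>\<^bsub>GL n\<^esub> B) \<otimes>\<^bsub>GL n\<^esub> A
      = A \<otimes>\<^bsub>GL n\<^esub> (inv\<^bsub>GL n\<^esub> B \<otimes>\<^bsub>GL n\<^esub> A \<otimes>\<^bsub>GL n\<^esub> B)"
proof -
  interpret group "GL n" by (rule GL_group)
  note A = assms(4) and B = assms(5) and rel = assms(6)
  obtain f where f: "A = eval_poly_mat f (A [^]\<^bsub>GL n\<^esub> q)"
    using Baumslag_Solitar_polynomial_in[OF assms(1,2,4-6)] by blast
  \<comment> \<open>The polynomial that recovers \<open>A\<close> from A^q is applied to A^p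
    instead. Since \<open>B\<close> intertwines A^p and A^q, this yields B A B^(-1), and as a
    polynomial in A^p it commutes with \<open>A\<close>.\<close>
  define D where "D = eval_poly_mat f (A [^]\<^bsub>GL n\<^esub> p)"
  have Ap: "A [^]\<^bsub>GL n\<^esub> p \<in> carrier (GL n)" and Aq: "A [^]\<^bsub>GL n\<^esub> q \<in> carrier (GL n)"
    using A by simp_all
  note carr = GL_carrier_mat[OF A] GL_carrier_mat[OF B] GL_carrier_mat[OF Ap] GL_carrier_mat[OF Aq]
  have "A [^]\<^bsub>GL n\<^esub> p \<otimes>\<^bsub>GL n\<^esub> B = B \<otimes>\<^bsub>GL n\<^esub> A [^]\<^bsub>GL n\<^esub> q"
    using A B by (simp add: m_assoc flip: rel) (simp flip: m_assoc)
  then have "D * B = B * A"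
    using eval_poly_mat_intertwine[OF carr(3,4,2), of f] by (simp add: GL_mult D_def flip: f)
  have "A [^]\<^bsub>GL n\<^esub> p \<otimes>\<^bsub>GL n\<^esub> A = A \<otimes>\<^bsub>GL n\<^esub> A [^]\<^bsub>GL n\<^esub> p"
    using int_pow_mult[OF A, of p 1] int_pow_mult[OF A, of 1 p] A by (simp add: add.commute)
  then have DA: "D * A = A * D"
    using eval_poly_mat_intertwine[OF carr(3,3,1), of f] by (simp add: GL_mult D_def)
  have Dc: "D \<in> carrier_mat n n" using carr by (simp add: D_def)
  define E where "E = B \<otimes>\<^bsub>GL n\<^esub> A \<otimes>\<^bsub>GL n\<^esub> inv\<^bsub>GL n\<^esub> B"
  have "E = D * B * inv\<^bsub>GL n\<^esub> B" by (simp add: E_def GL_mult \<open>D * B = B * A\<close>)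
  also have "\<dots> = D * (B \<otimes>\<^bsub>GL n\<^esub> inv\<^bsub>GL n\<^esub> B)"
    unfolding GL_mult by (rule assoc_mult_mat[OF Dc carr(2) GL_carrier_mat[OF inv_closed[OF B]]])
  also have "\<dots> = D" using B Dc by (simp add: GL_one)
  finally have EA: "E \<otimes>\<^bsub>GL n\<^esub> A = A \<otimes>\<^bsub>GL n\<^esub> E" using DA by (simp add: GL_mult)
  \<comment> \<open>Conjugation by \<open>B\<close> takes \<open>E\<close> to \<open>A\<close> and
    \<open>A\<close> to B^(-1) A B, so it carries \<open>EA\<close> to the required
    commutation.\<close>
  have "inv\<^bsub>GL n\<^esub> B \<otimes>\<^bsub>GL n\<^esub> A \<otimes>\<^bsub>GL n\<^esub> B \<otimes>\<^bsub>GL n\<^esub> A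
      = inv\<^bsub>GL n\<^esub> B \<otimes>\<^bsub>GL n\<^esub> (A \<otimes>\<^bsub>GL n\<^esub> E) \<otimes>\<^bsub>GL n\<^esub> B"
    using A B by (simp add: E_def m_assoc)
  also have "\<dots> = inv\<^bsub>GL n\<^esub> B \<otimes>\<^bsub>GL n\<^esub> (E \<otimes>\<^bsub>GL n\<^esub> A) \<otimes>\<^bsub>GL n\<^esub> B"
    by (simp only: EA)
  also have "\<dots> = inv\<^bsub>GL n\<^esub> B \<otimes>\<^bsub>GL n\<^esub> B \<otimes>\<^bsub>GL n\<^esub>
      (A \<otimes>\<^bsub>GL n\<^esub> (inv\<^bsub>GL n\<^esub> B \<otimes>\<^bsub>GL n\<^esub> A \<otimes>\<^bsub>GL n\<^esub> B))"
    using A B unfolding E_def by (simp only: m_assoc m_closed inv_closed)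
  also have "\<dots> = A \<otimes>\<^bsub>GL n\<^esub> (inv\<^bsub>GL n\<^esub> B \<otimes>\<^bsub>GL n\<^esub> A \<otimes>\<^bsub>GL n\<^esub> B)"
    using A B by simp
  finally show ?thesis using f unfolding polynomial_in_def by blast
qed

end
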